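(* Let $d \ge 0$ and $n\ge 1$ be integers, and let $\alpha$ and $\beta$ be partitions of $d$ into at most $n$ parts. If $\alpha \succeq \beta$, then $[\alpha] - [\beta] \in S_n$.
   Context: A partition of $d$ into at most $n$ parts is a weakly decreasing sequence $\alpha = (\alpha_1,\dots,\alpha_n)$ of nonnegative integers with $\alpha_1+\dots+\alpha_n = d$. For two such partitions, write $\alpha \searrow \beta$ if for some indices $k<l$ we have $\beta_k = \alpha_k - 1$, $\beta_l = \alpha_l+1$ and $\beta_i = \alpha_i$ for all $i \ne k,l$. The relation $\succeq$ is the reflexive transitive closure of $\searrow$ on the set of partitions of $d$ into at most $n$ parts (so all intermediate sequences in a chain are themselves partitions). For a partition $\alpha$, the normalized monomial symmetric function is $[\alpha] = \frac{1}{n!}\sum_{\sigma \in \mathfrak{S}_n} \prod_{j=1}^n x_{\sigma(j)}^{\alpha_j} \in \mathbb{R}[x_1,\dots,x_n]$, where $\mathfrak{S}_n$ is the symmetric group. $S_n \subseteq \mathbb{R}[x_1,\dots,x_n]$ denotes the set of all polynomials of the form $\sum_{\varepsilon \in \{0,1\}^n} r_{\varepsilon} \prod_{j=1}^n x_j^{\varepsilon_j}$, where each $r_{\varepsilon}$ is a (finite) sum of squares of polynomials in $\mathbb{R}[x_1,\dots,x_n]$. Equivalently, $S_n$ is the semiring generated by the variables $x_1,\dots,x_n$ and the squares of all polynomials in $\mathbb{R}[x_1,\dots,x_n]$. *)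

theory Defs
  imports Complex_Main "HOL-Library.FuncSet" "HOL-Library.Poly_Mapping"
    "HOL-Combinatorics.Permutations"
begin

text \<open>
  Real polynomials in variables indexed by the naturals: finitely supported maps from monomials
  (finitely supported exponent vectors) to coefficients, with the convolution product.
\<close>

type_synonym rpoly = "(nat \<Rightarrow>\<^sub>0 nat) \<Rightarrow>\<^sub>0 real"

definition Var :: "nat \<Rightarrow> rpoly" where
  "Var i = Poly_Mapping.single (Poly_Mapping.single i 1) 1"

definition Const :: "real \<Rightarrow> rpoly" where
  "Const c = Poly_Mapping.single 0 c"

text \<open>The subring \<open>\<real>[x\<^sub>1, \<dots>, x\<^sub>n]\<close>.\<close>

definition polys :: "nat \<Rightarrow> rpoly set" where
  "polys n = {p. \<forall>m \<in> Poly_Mapping.keys p. Poly_Mapping.keys m \<subseteq> {1..n}}"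

text \<open>
  A tuple indexed by \<open>{1..n}\<close> is represented by a function that vanishes outside
  \<open>{1..n}\<close>, so that equality of functions is equality of tuples.
\<close>

definition partitions :: "nat \<Rightarrow> nat \<Rightarrow> (nat \<Rightarrow> nat) set" where
  "partitions d n = {\<alpha>.
     (\<forall>i j. 1 \<le> i \<and> i \<le> j \<and> j \<le> n \<longrightarrow> \<alpha> j \<le> \<alpha> i) \<and>
     (\<Sum>i = 1..n. \<alpha> i) = d \<and>
     (\<forall>i. i \<notin> {1..n} \<longrightarrow> \<alpha> i = 0)}"

text \<open>The first equation is \<open>\<beta>\<^sub>k = \<alpha>\<^sub>k - 1\<close>, without truncated subtraction.\<close>

definition step :: "nat \<Rightarrow> (nat \<Rightarrow> nat) \<Rightarrow> (nat \<Rightarrow> nat) \<Rightarrow> bool" where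
  "step n \<alpha> \<beta> \<longleftrightarrow> (\<exists>k l. 1 \<le> k \<and> k < l \<and> l \<le> n \<and>
     \<alpha> k = \<beta> k + 1 \<and> \<beta> l = \<alpha> l + 1 \<and>
     (\<forall>i \<in> {1..n}. i \<noteq> k \<and> i \<noteq> l \<longrightarrow> \<beta> i = \<alpha> i))"

definition dominates :: "nat \<Rightarrow> nat \<Rightarrow> (nat \<Rightarrow> nat) \<Rightarrow> (nat \<Rightarrow> nat) \<Rightarrow> bool" where
  "dominates d n =
     (\<lambda>\<alpha> \<beta>. \<alpha> \<in> partitions d n \<and> \<beta> \<in> partitions d n \<and> step n \<alpha> \<beta>)\<^sup>*\<^sup>*"

definition msym :: "nat \<Rightarrow> (nat \<Rightarrow> nat) \<Rightarrow> rpoly" where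
  "msym n \<alpha> = Const (1 / fact n) *
     (\<Sum>\<sigma> | \<sigma> permutes {1..n}. \<Prod>j = 1..n. Var (\<sigma> j) ^ \<alpha> j)"

definition sos :: "nat \<Rightarrow> rpoly set" where
  "sos n = {p. \<exists>qs. set qs \<subseteq> polys n \<and> p = (\<Sum>q\<leftarrow>qs. q\<^sup>2)}"

definition S :: "nat \<Rightarrow> rpoly set" where
  "S n = {p. \<exists>r. (\<forall>\<epsilon> \<in> {1..n} \<rightarrow>\<^sub>E {0, 1}. r \<epsilon> \<in> sos n) \<and>
     p = (\<Sum>\<epsilon> \<in> {1..n} \<rightarrow>\<^sub>E {0, 1}. r \<epsilon> * (\<Prod>j = 1..n. Var j ^ \<epsilon> j))}"

end

theory Submission imports Defs begin

text \<open>
  By transitivity it suffices to treat one step \<open>\<alpha> \<searrow> \<beta>\<close>, which moves a unit from position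
  \<open>k\<close> to position \<open>l\<close>. Write \<open>a = \<alpha>\<^sub>k\<close> and \<open>b = \<alpha>\<^sub>l\<close>. Since \<open>\<beta>\<close> is again weakly decreasing,
  \<open>a - 1 \<ge> b + 1\<close>. Averaging the summand for a permutation \<open>\<sigma>\<close> with the one for \<open>\<sigma>\<close> composed with
  the transposition of \<open>k\<close> and \<open>l\<close> does not change the symmetric sum. After this averaging, the
  summand of \<open>[\<alpha>] - [\<beta>]\<close> for \<open>\<sigma>\<close> is, up to a positive constant, a monomial in the variables
  other than \<open>y = x\<^bsub>\<sigma>(k)\<^esub>\<close> and \<open>z = x\<^bsub>\<sigma>(l)\<^esub>\<close>, times
  \[ y^a z^b + z^a y^b - y^{a-1} z^{b+1} - z^{a-1} y^{b+1}
     = (y z)^b (y - z) (y^m - z^m)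
     = (y z)^b (y - z)^2 \sum_{i<m} z^{m-1-i} y^i, \]
  where \<open>m = a - b - 1 \<ge> 1\<close>. The right-hand side is a sum of products of variables and a square, so
  it lies in \<open>S\<^sub>n\<close> as soon as \<open>S\<^sub>n\<close> is known to be closed under sums and under multiplication by
  variables and by squares. The only one of these closure properties with content is
  \<open>S_mult_Var\<close>: a factor \<open>x\<^sub>i\<^sup>2\<close> that arises is absorbed into the sum-of-squares coefficient. The
  averaging is \<open>twice_sum_permutes_monomials\<close>, and the displayed identity is \<open>exchange_difference\<close>.
\<close>

section \<open>Closure properties of the polynomial ring and of sums of squares\<close>

lemma polys_diff: "p \<in> polys n \<Longrightarrow> q \<in> polys n \<Longrightarrow> p - q \<in> polys n"
  using keys_diff[of p q] unfolding polys_def by blast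

lemma polys_mult:
  assumes "p \<in> polys n" "q \<in> polys n"
  shows "p * q \<in> polys n"
proof -
  have "Poly_Mapping.keys m \<subseteq> {1..n}" if m: "m \<in> Poly_Mapping.keys (p * q)" for m
  proof -
    obtain a b where "m = a + b" "a \<in> Poly_Mapping.keys p" "b \<in> Poly_Mapping.keys q"
      using m keys_mult[of p q] by auto
    then show ?thesis
      using assms Poly_Mapping.keys_add[of a b] unfolding polys_def by blast
  qed
  then show ?thesis by (simp add: polys_def)
qed

lemma polys_Var: "i \<in> {1..n} \<Longrightarrow> Var i \<in> polys n"
  by (simp add: polys_def Var_def)

lemma polys_Const: "Const c \<in> polys n"
  by (simp add: polys_def Const_def)

lemma Const_mult: "Const a * Const b = Const (a * b)"
  by (simp add: Const_def mult_single)

lemma Const_add: "Const a + Const b = Const (a + b)"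
  by (simp add: Const_def single_add)

lemma sos_0: "0 \<in> sos n"
  unfolding sos_def by (auto intro: exI[of _ "[]"])

lemma sos_square: "q \<in> polys n \<Longrightarrow> q\<^sup>2 \<in> sos n"
  unfolding sos_def by (auto intro: exI[of _ "[q]"])

lemma sos_add:
  assumes "p \<in> sos n" "q \<in> sos n"
  shows "p + q \<in> sos n"
proof -
  obtain ps qs where "set ps \<subseteq> polys n" "p = (\<Sum>q\<leftarrow>ps. q\<^sup>2)"
    and "set qs \<subseteq> polys n" "q = (\<Sum>q\<leftarrow>qs. q\<^sup>2)"
    using assms unfolding sos_def by blast
  then show ?thesis
    unfolding sos_def by (auto intro!: exI[of _ "ps @ qs"])
qed

lemma sos_mult_square:
  assumes "s \<in> polys n" "p \<in> sos n"
  shows "s\<^sup>2 * p \<in> sos n"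
proof -
  obtain qs where qs: "set qs \<subseteq> polys n" "p = (\<Sum>q\<leftarrow>qs. q\<^sup>2)"
    using assms(2) unfolding sos_def by blast
  have "s\<^sup>2 * p = (\<Sum>q\<leftarrow>map ((*) s) qs. q\<^sup>2)"
    by (simp add: qs(2) sum_list_const_mult[symmetric] o_def power_mult_distrib)
  moreover have "set (map ((*) s) qs) \<subseteq> polys n"
    using qs(1) assms(1) by (auto intro: polys_mult)
  ultimately show ?thesis unfolding sos_def by blast
qed

section \<open>Closure properties of \<open>S\<close>\<close>

lemma S_0: "0 \<in> S n"
  unfolding S_def by (auto intro!: exI[of _ "\<lambda>_. 0"] sos_0)

lemma S_add:
  assumes "p \<in> S n" "q \<in> S n"
  shows "p + q \<in> S n"
proof -
  obtain r r' where
    "\<forall>\<epsilon> \<in> {1..n} \<rightarrow>\<^sub>E {0, 1}. r \<epsilon> \<in> sos n"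
    "p = (\<Sum>\<epsilon> \<in> {1..n} \<rightarrow>\<^sub>E {0, 1}. r \<epsilon> * (\<Prod>j = 1..n. Var j ^ \<epsilon> j))"
    "\<forall>\<epsilon> \<in> {1..n} \<rightarrow>\<^sub>E {0, 1}. r' \<epsilon> \<in> sos n"
    "q = (\<Sum>\<epsilon> \<in> {1..n} \<rightarrow>\<^sub>E {0, 1}. r' \<epsilon> * (\<Prod>j = 1..n. Var j ^ \<epsilon> j))"
    using assms unfolding S_def by blast
  then show ?thesis
    unfolding S_def
    by (auto intro!: exI[of _ "\<lambda>\<epsilon>. r \<epsilon> + r' \<epsilon>"] sos_add simp: sum.distrib distrib_right)
qed

lemma S_sum: "(\<And>x. x \<in> A \<Longrightarrow> f x \<in> S n) \<Longrightarrow> sum f A \<in> S n"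
  by (induction A rule: infinite_finite_induct) (auto intro: S_0 S_add)

lemma S_term:
  assumes "\<delta> \<in> {1..n} \<rightarrow>\<^sub>E {0, 1}" "r \<in> sos n"
  shows "r * (\<Prod>j = 1..n. Var j ^ \<delta> j) \<in> S n"
proof -
  have "r * (\<Prod>j = 1..n. Var j ^ \<delta> j) =
      (\<Sum>\<epsilon> \<in> {1..n} \<rightarrow>\<^sub>E {0, 1}. if \<epsilon> = \<delta> then r * (\<Prod>j = 1..n. Var j ^ \<epsilon> j) else 0)"
    using assms(1) by (subst sum.delta) (auto intro: finite_PiE)
  also have "\<dots> = (\<Sum>\<epsilon> \<in> {1..n} \<rightarrow>\<^sub>E {0, 1}.
      (if \<epsilon> = \<delta> then r else 0) * (\<Prod>j = 1..n. Var j ^ \<epsilon> j))"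
    by (intro sum.cong) auto
  finally show ?thesis
    unfolding S_def using assms(2) sos_0 by (intro CollectI exI[of _ "\<lambda>\<epsilon>. if \<epsilon> = \<delta> then r else 0"]) auto
qed

text \<open>
  Multiplication by a fixed polynomial is additive and \<open>S n\<close> is closed under sums, so closure under
  such a multiplication needs checking on single terms only.
\<close>

lemma S_mult_if_terms:
  assumes terms: "\<And>\<epsilon> r. \<epsilon> \<in> {1..n} \<rightarrow>\<^sub>E {0, 1} \<Longrightarrow> r \<in> sos n \<Longrightarrow>
      s * (r * (\<Prod>j = 1..n. Var j ^ \<epsilon> j)) \<in> S n"
    and "p \<in> S n"
  shows "s * p \<in> S n"
proof -
  obtain r where r: "\<forall>\<epsilon> \<in> {1..n} \<rightarrow>\<^sub>E {0, 1}. r \<epsilon> \<in> sos n"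
    and p: "p = (\<Sum>\<epsilon> \<in> {1..n} \<rightarrow>\<^sub>E {0, 1}. r \<epsilon> * (\<Prod>j = 1..n. Var j ^ \<epsilon> j))"
    using assms(2) unfolding S_def by blast
  show ?thesis
    unfolding p sum_distrib_left using r by (intro S_sum terms) blast+
qed

lemma S_mult_square:
  assumes "s \<in> polys n" "p \<in> S n"
  shows "s\<^sup>2 * p \<in> S n"
proof (rule S_mult_if_terms[OF _ assms(2)])
  fix \<epsilon> r assume "\<epsilon> \<in> {1..n} \<rightarrow>\<^sub>E {0, 1::nat}" "r \<in> sos n"
  then show "s\<^sup>2 * (r * (\<Prod>j = 1..n. Var j ^ \<epsilon> j)) \<in> S n"
    using S_term[OF _ sos_mult_square[OF assms(1)]] by (simp add: mult.assoc)
qed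

text \<open>
  If \<open>x\<^sub>i\<close> does not divide the squarefree monomial \<open>x\<^sup>\<epsilon>\<close>, then \<open>x\<^sub>i x\<^sup>\<epsilon>\<close> is again squarefree; otherwise
  \<open>x\<^sub>i x\<^sup>\<epsilon>\<close> is the square \<open>x\<^sub>i\<^sup>2\<close> times the squarefree monomial without \<open>x\<^sub>i\<close>.
\<close>

lemma S_mult_Var:
  assumes i: "i \<in> {1..n}" and "p \<in> S n"
  shows "Var i * p \<in> S n"
proof (rule S_mult_if_terms[OF _ assms(2)])
  fix \<epsilon> r assume \<epsilon>: "\<epsilon> \<in> {1..n} \<rightarrow>\<^sub>E {0, 1::nat}" and r: "r \<in> sos n"
  let ?M = "\<lambda>\<epsilon>. \<Prod>j = 1..n. Var j ^ \<epsilon> j"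
  define R where "R = (\<Prod>j \<in> {1..n} - {i}. Var j ^ \<epsilon> j)"
  have upd: "?M (\<epsilon>(i := c)) = Var i ^ c * R" for c
    using i unfolding R_def by (subst prod.remove[of _ i]) (auto intro!: prod.cong)
  have M: "?M \<epsilon> = Var i ^ \<epsilon> i * R"
    using upd[of "\<epsilon> i"] by simp
  have mem: "\<epsilon>(i := c) \<in> {1..n} \<rightarrow>\<^sub>E {0, 1}" if "c \<in> {0, 1}" for c
    using PiE_fun_upd[OF that \<epsilon>, of i] by (simp only: insert_absorb[OF i])
  have "\<epsilon> i = 0 \<or> \<epsilon> i = 1"
    using \<epsilon> i by (auto simp: PiE_def Pi_def)
  then show "Var i * (r * ?M \<epsilon>) \<in> S n"
  proof
    assume "\<epsilon> i = 0"
    then have eq: "Var i * (r * ?M \<epsilon>) = r * ?M (\<epsilon>(i := 1))"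
      unfolding upd M by (simp add: mult_ac)
    show ?thesis unfolding eq by (intro S_term mem r) simp
  next
    assume "\<epsilon> i = 1"
    then have eq: "Var i * (r * ?M \<epsilon>) = ((Var i)\<^sup>2 * r) * ?M (\<epsilon>(i := 0))"
      unfolding upd M by (simp add: mult_ac power2_eq_square)
    show ?thesis unfolding eq by (intro S_term mem sos_mult_square polys_Var i r) simp
  qed
qed

lemma S_mult_Var_power: "i \<in> {1..n} \<Longrightarrow> p \<in> S n \<Longrightarrow> Var i ^ a * p \<in> S n"
  by (induction a) (simp_all add: mult.assoc S_mult_Var)

lemma S_mult_monomial:
  assumes "\<And>j. j \<in> A \<Longrightarrow> f j \<in> {1..n}" "p \<in> S n"
  shows "(\<Prod>j \<in> A. Var (f j) ^ a j) * p \<in> S n"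
  using assms by (induction A rule: infinite_finite_induct) (simp_all add: mult.assoc S_mult_Var_power)

lemma S_square:
  assumes "q \<in> polys n"
  shows "q\<^sup>2 \<in> S n"
proof -
  let ?z = "\<lambda>j \<in> {1..n}. 0::nat"
  have "(\<Prod>j = 1..n. Var j ^ ?z j) = 1"
    by (intro prod.neutral) auto
  then show ?thesis
    using S_term[of ?z n "q\<^sup>2"] sos_square[OF assms] by auto
qed

lemma S_mult_nonneg_Const:
  assumes "c \<ge> 0" "p \<in> S n"
  shows "Const c * p \<in> S n"
  using S_mult_square[OF polys_Const[of "sqrt c"] assms(2)] assms(1)
  by (simp add: power2_eq_square Const_mult)

section \<open>The exchange of one unit between two variables\<close>

text \<open>
  The factor \<open>y\<^sup>m - z\<^sup>m\<close> has the same sign as \<open>y - z\<close> for nonnegative \<open>y\<close> and \<open>z\<close>; dividing it by \<open>y - z\<close>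
  turns the product into a square times monomials with coefficient one. The products are nested to
  the right so that the closure rules for \<open>S\<close> peel off one power of a variable at a time.
\<close>

lemma exchange_difference:
  fixes y z :: "'a :: comm_ring_1"
  shows "y ^ (b + m + 1) * z ^ b + z ^ (b + m + 1) * y ^ b
       - (y ^ (b + m) * z ^ (b + 1) + z ^ (b + m) * y ^ (b + 1))
     = (\<Sum>i<m. y ^ b * (z ^ b * (z ^ (m - Suc i) * (y ^ i * (y - z)\<^sup>2))))"
proof -
  have "y ^ (b + m + 1) * z ^ b + z ^ (b + m + 1) * y ^ b
       - (y ^ (b + m) * z ^ (b + 1) + z ^ (b + m) * y ^ (b + 1))
     = y ^ b * z ^ b * (y - z) * (y ^ m - z ^ m)"
    by (simp add: power_add algebra_simps)
  also have "\<dots> = y ^ b * z ^ b * (y - z)\<^sup>2 * (\<Sum>i<m. z ^ (m - Suc i) * y ^ i)"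
    by (subst power_diff_sumr2) (simp add: power2_eq_square mult_ac)
  finally show ?thesis
    by (simp add: sum_distrib_left mult_ac)
qed

lemma exchange_in_S:
  assumes "u \<in> {1..n}" "v \<in> {1..n}"
  shows "Var u ^ (b + m + 1) * Var v ^ b + Var v ^ (b + m + 1) * Var u ^ b
       - (Var u ^ (b + m) * Var v ^ (b + 1) + Var v ^ (b + m) * Var u ^ (b + 1)) \<in> S n"
  unfolding exchange_difference
  by (intro S_sum S_mult_Var_power S_square polys_diff polys_Var assms)

text \<open>
  Composing with the transposition of \<open>k\<close> and \<open>l\<close> permutes the summands, so the sum may be added to its
  transposed copy; each summand then carries the two exponents on the two variables in both ways.
\<close>

lemma twice_sum_permutes_monomials:
  fixes x :: "nat \<Rightarrow> 'a :: comm_ring_1"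
  assumes kl: "k \<in> {1..n}" "l \<in> {1..n}" "k \<noteq> l"
  shows "2 * (\<Sum>\<sigma> | \<sigma> permutes {1..n}. \<Prod>j = 1..n. x (\<sigma> j) ^ \<gamma> j) =
    (\<Sum>\<sigma> | \<sigma> permutes {1..n}. (\<Prod>j \<in> {1..n} - {k, l}. x (\<sigma> j) ^ \<gamma> j) *
       (x (\<sigma> k) ^ \<gamma> k * x (\<sigma> l) ^ \<gamma> l + x (\<sigma> l) ^ \<gamma> k * x (\<sigma> k) ^ \<gamma> l))"
proof -
  let ?M = "\<lambda>\<sigma>. \<Prod>j = 1..n. x (\<sigma> j) ^ \<gamma> j"
  let ?R = "\<lambda>\<sigma>. \<Prod>j \<in> {1..n} - {k, l}. x (\<sigma> j) ^ \<gamma> j"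
  let ?t = "transpose k l"
  have split: "?M \<sigma> = ?R \<sigma> * (x (\<sigma> k) ^ \<gamma> k * x (\<sigma> l) ^ \<gamma> l)" for \<sigma>
  proof -
    have "{1..n} = insert k (insert l ({1..n} - {k, l}))"
      using kl by auto
    then have "?M \<sigma> = (\<Prod>j \<in> insert k (insert l ({1..n} - {k, l})). x (\<sigma> j) ^ \<gamma> j)"
      by simp
    then show ?thesis using kl(3) by (simp add: mult_ac)
  qed
  have R: "?R (\<sigma> \<circ> ?t) = ?R \<sigma>" for \<sigma>
    by (intro prod.cong) (auto simp: transpose_def)
  have "sum ?M {\<sigma>. \<sigma> permutes {1..n}} = (\<Sum>\<sigma> | \<sigma> permutes {1..n}. ?M (\<sigma> \<circ> ?t))"
    by (rule sum_permutations_compose_right) (use kl in \<open>auto intro: permutes_swap_id\<close>)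
  also have "\<dots> = (\<Sum>\<sigma> | \<sigma> permutes {1..n}. ?R \<sigma> * (x (\<sigma> l) ^ \<gamma> k * x (\<sigma> k) ^ \<gamma> l))"
    by (simp only: split R) (simp add: mult_ac)
  finally have swapped: "sum ?M {\<sigma>. \<sigma> permutes {1..n}} =
      (\<Sum>\<sigma> | \<sigma> permutes {1..n}. ?R \<sigma> * (x (\<sigma> l) ^ \<gamma> k * x (\<sigma> k) ^ \<gamma> l))" .
  show ?thesis
    unfolding mult_2 distrib_left sum.distrib
    by (intro arg_cong2[of _ _ _ _ "(+)"] swapped) (simp only: split)
qed

lemma msym_diff_in_S_if_step:
  assumes \<beta>: "\<beta> \<in> partitions d n" and "step n \<alpha> \<beta>"
  shows "msym n \<alpha> - msym n \<beta> \<in> S n"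
proof -
  obtain k l where kl: "1 \<le> k" "k < l" "l \<le> n"
    and k: "\<alpha> k = \<beta> k + 1" and l: "\<beta> l = \<alpha> l + 1"
    and rest: "\<And>i. i \<in> {1..n} \<Longrightarrow> i \<noteq> k \<Longrightarrow> i \<noteq> l \<Longrightarrow> \<beta> i = \<alpha> i"
    using assms(2) unfolding step_def by blast
  define b where "b = \<alpha> l"
  define m where "m = \<beta> k - b"
  \<comment> \<open>As \<open>\<beta>\<close> is weakly decreasing, the difference defining \<open>m\<close> is not truncated.\<close>
  have "\<beta> l \<le> \<beta> k"
    using \<beta> kl unfolding partitions_def by auto
  then have exponents: "\<alpha> k = b + m + 1" "\<alpha> l = b" "\<beta> k = b + m" "\<beta> l = b + 1"
    using k l by (auto simp: b_def m_def)
  have kl': "k \<in> {1..n}" "l \<in> {1..n}" "k \<noteq> l"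
    using kl by auto
  let ?A = "\<lambda>\<gamma>. \<Sum>\<sigma> | \<sigma> permutes {1..n}. \<Prod>j = 1..n. Var (\<sigma> j) ^ \<gamma> j"
  let ?R = "\<lambda>\<gamma> \<sigma>. \<Prod>j \<in> {1..n} - {k, l}. Var (\<sigma> j) ^ \<gamma> j"
  let ?c = "1 / (2 * fact n) :: real"
  have "?R \<beta> = ?R \<alpha>"
    using rest by (intro ext prod.cong) auto
  then have "2 * ?A \<alpha> - 2 * ?A \<beta> = (\<Sum>\<sigma> | \<sigma> permutes {1..n}. ?R \<alpha> \<sigma> *
      (Var (\<sigma> k) ^ (b + m + 1) * Var (\<sigma> l) ^ b + Var (\<sigma> l) ^ (b + m + 1) * Var (\<sigma> k) ^ b
       - (Var (\<sigma> k) ^ (b + m) * Var (\<sigma> l) ^ (b + 1) + Var (\<sigma> l) ^ (b + m) * Var (\<sigma> k) ^ (b + 1))))"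
    unfolding twice_sum_permutes_monomials[OF kl'] exponents sum_subtractf[symmetric]
      right_diff_distrib[symmetric] by (metis (no_types, lifting) right_diff_distrib)
  also have "\<dots> \<in> S n"
  proof (intro S_sum S_mult_monomial exchange_in_S)
    fix \<sigma> assume "\<sigma> \<in> {\<sigma>. \<sigma> permutes {1..n}}"
    then have \<sigma>: "\<sigma> j \<in> {1..n}" if "j \<in> {1..n}" for j
      using that permutes_in_image[of \<sigma> "{1..n}" j] by auto
    show "\<sigma> k \<in> {1..n}" "\<sigma> l \<in> {1..n}"
      using \<sigma> kl' by blast+
    show "\<sigma> j \<in> {1..n}" if "j \<in> {1..n} - {k, l}" for j
      using \<sigma> that by blast
  qed
  finally have "Const ?c * (2 * ?A \<alpha> - 2 * ?A \<beta>) \<in> S n"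
    by (rule S_mult_nonneg_Const[rotated]) simp
  moreover have "Const (1 / fact n) = Const ?c * 2"
    using Const_add[of ?c ?c] by (simp add: mult_2_right)
  ultimately show ?thesis
    unfolding msym_def by (simp add: algebra_simps)
qed

theorem lemma2:
  fixes d n :: nat and \<alpha> \<beta> :: "nat \<Rightarrow> nat"
  assumes "n \<ge> 1"
    and "\<alpha> \<in> partitions d n" and "\<beta> \<in> partitions d n"
    and "dominates d n \<alpha> \<beta>"
  shows "msym n \<alpha> - msym n \<beta> \<in> S n"
  using assms(4) unfolding dominates_def
proof (induction rule: rtranclp_induct)
  case base
  show ?case by (simp add: S_0)
next
  case (step \<gamma> \<delta>)
  then have "(msym n \<alpha> - msym n \<gamma>) + (msym n \<gamma> - msym n \<delta>) \<in> S n"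
    by (blast intro: S_add msym_diff_in_S_if_step)
  then show ?case by simp
qed

end
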